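(* For any upset $\alpha$ and any argument $\Gamma\rhd\Delta$, if $\Gamma\rhd\Delta$ is classically invalid (i.e. not classically valid), then it is $\alpha$-preservation invalid (i.e. not $\alpha$-preservation valid).
   Context: Language: $\mathcal{L}$ is the propositional language with countably infinitely many atomic sentences and connectives $\neg,\lor$ (other classical connectives defined as usual). An argument $\Gamma\rhd\Delta$ is a pair of finite (possibly empty) sets $\Gamma,\Delta$ of sentences of $\mathcal{L}$. A probabilistic model is $\langle W,\mathcal{A},[\![\cdot]\!],P\rangle$ where $W$ is a nonempty set (of worlds); $\mathcal{A}\subseteq\mathcal{P}(W)$ contains $\emptyset$ and is closed under complement in $W$ and binary union; $[\![\cdot]\!]:\mathcal{L}\to\mathcal{A}$ satisfies $[\![\neg\phi]\!]=W\setminus[\![\phi]\!]$ and $[\![\phi\lor\psi]\!]=[\![\phi]\!]\cup[\![\psi]\!]$; and $P:\mathcal{A}\to[0,1]$ is a finitely additive probability ($P(\emptyset)=0$, $P(W\setminus A)=1-P(A)$, and $P(A\cup B)=P(A)+P(B)$ for disjoint $A,B\in\mathcal{A}$). Write $P(\phi)$ for $P([\![\phi]\!])$. An upset is a set $\alpha\subseteq[0,1]$ with $1\in\alpha$, $0\notin\alpha$, and such that $x\in\alpha$, $x\le y\le 1$ imply $y\in\alpha$. $\Gamma\rhd\Delta$ is $\alpha$-preservation valid iff in every probabilistic model, if $P(\gamma)\in\alpha$ for every $\gamma\in\Gamma$, then $P(\delta)\in\alpha$ for some $\delta\in\Delta$. $\Gamma\rhd\Delta$ is classically valid iff for every probabilistic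 model and every world $w\in W$, if $w\in[\![\gamma]\!]$ for every $\gamma\in\Gamma$, then $w\in[\![\delta]\!]$ for some $\delta\in\Delta$. *)

theory Defs
  imports "HOL-Analysis.Analysis"
begin

datatype sentence = Atom nat | Neg sentence | Or sentence sentence

text \<open>
  The fields are \<open>W\<close> (worlds), \<open>A\<close> (events), \<open>I\<close> (interpretation of sentences) and \<open>P\<close>
  (probability). By \<open>algebra_iff_Un\<close>, \<open>algebra W A\<close> says that \<open>A\<close> is a set of subsets of \<open>W\<close>
  containing \<open>{}\<close> and closed under complement in \<open>W\<close> and binary union. \<open>P\<close> is a total function
  in HOL; only its values on \<open>A\<close> are constrained or used.
\<close>

locale prob_model =
  fixes W :: "'w set"
    and A :: "'w set set"
    and I :: "sentence \<Rightarrow> 'w set"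
    and P :: "'w set \<Rightarrow> real"
  assumes worlds_nonempty: "W \<noteq> {}"
    and events_algebra: "algebra W A"
    and interp_event: "I \<phi> \<in> A"
    and interp_Neg: "I (Neg \<phi>) = W - I \<phi>"
    and interp_Or: "I (Or \<phi> \<psi>) = I \<phi> \<union> I \<psi>"
    and prob_range: "X \<in> A \<Longrightarrow> P X \<in> {0..1}"
    and prob_empty: "P {} = 0"
    and prob_compl: "X \<in> A \<Longrightarrow> P (W - X) = 1 - P X"
    and prob_additive: "additive A P"

definition upset :: "real set \<Rightarrow> bool" where
  "upset \<alpha> \<longleftrightarrow> \<alpha> \<subseteq> {0..1} \<and> 1 \<in> \<alpha> \<and> 0 \<notin> \<alpha> \<and>
     (\<forall>x y. x \<in> \<alpha> \<longrightarrow> x \<le> y \<longrightarrow> y \<le> 1 \<longrightarrow> y \<in> \<alpha>)"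

text \<open>
  HOL cannot quantify over types inside a formula, so validity takes the type from which worlds
  are drawn as an explicit argument; \<open>W\<close> ranges over all nonempty sets of that type.
\<close>

definition preservation_valid ::
    "'w itself \<Rightarrow> real set \<Rightarrow> sentence set \<Rightarrow> sentence set \<Rightarrow> bool" where
  "preservation_valid _ \<alpha> \<Gamma> \<Delta> \<longleftrightarrow>
     (\<forall>(W :: 'w set) A I P. prob_model W A I P \<longrightarrow>
        (\<forall>\<gamma>\<in>\<Gamma>. P (I \<gamma>) \<in> \<alpha>) \<longrightarrow> (\<exists>\<delta>\<in>\<Delta>. P (I \<delta>) \<in> \<alpha>))"

definition classically_valid ::
    "'w itself \<Rightarrow> sentence set \<Rightarrow> sentence set \<Rightarrow> bool" where
  "classically_valid _ \<Gamma> \<Delta> \<longleftrightarrow>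
     (\<forall>(W :: 'w set) A I P. prob_model W A I P \<longrightarrow>
        (\<forall>w\<in>W. (\<forall>\<gamma>\<in>\<Gamma>. w \<in> I \<gamma>) \<longrightarrow> (\<exists>\<delta>\<in>\<Delta>. w \<in> I \<delta>)))"

end

theory Submission
  imports Defs
begin

text \<open>An upset contains 1 and omits 0, so for a probability that takes only the values 0 and
  1, lying in \<alpha> amounts to being 1. If \<open>w\<close> refutes the argument classically, the
  model from \<open>prob_model_of_world\<close> gives all premises probability 1 and all conclusions
  probability 0. Only truth values at \<open>w\<close> are carried over, so \<open>'v\<close> and
  \<open>'w\<close> may differ.\<close>

text \<open>
  Collapsing a model to the truth values at a single world transfers the counterexample to any
  type of worlds, with every sentence getting probability 0 or 1.
\<close>

lemma prob_model_of_world: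
  fixes I :: "sentence \<Rightarrow> 'v set"
  assumes "prob_model W A I P" and "w \<in> W"
  shows "prob_model (UNIV :: 'w set) {{}, UNIV} (\<lambda>\<phi>. if w \<in> I \<phi> then UNIV else {}) (\<lambda>X. of_bool (X = UNIV))"
proof -
  interpret prob_model W A I P by fact
  show ?thesis
  proof (rule prob_model.intro)
    show "algebra (UNIV :: 'w set) {{}, UNIV}"
      by (auto simp: algebra_iff_Un)
    show "additive {{}, UNIV :: 'w set} (\<lambda>X. of_bool (X = UNIV) :: real)"
      by (auto simp: additive_def)
  \<comment> \<open>Negation needs \<open>w \<in> W\<close>: only then does
    \<open>w \<in> W - I \<phi>\<close> reduce to \<open>w \<notin> I \<phi>\<close>.\<close>
  qed (use \<open>w \<in> W\<close> in \<open>auto simp: interp_Neg interp_Or\<close>)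
qed

theorem fact19:
  fixes \<alpha> :: "real set"
    and \<Gamma> \<Delta> :: "sentence set"
  assumes "upset \<alpha>"
    and "finite \<Gamma>" and "finite \<Delta>"
    and "\<not> classically_valid TYPE('v) \<Gamma> \<Delta>"
  shows "\<not> preservation_valid TYPE('w) \<alpha> \<Gamma> \<Delta>"
proof
  assume valid: "preservation_valid TYPE('w) \<alpha> \<Gamma> \<Delta>"
  from assms(4) obtain W :: "'v set" and A I P w
    where model: "prob_model W A I P" "w \<in> W"
      and \<Gamma>: "\<forall>\<gamma>\<in>\<Gamma>. w \<in> I \<gamma>" and \<Delta>: "\<forall>\<delta>\<in>\<Delta>. w \<notin> I \<delta>"
    unfolding classically_valid_def by blast
  define J :: "sentence \<Rightarrow> 'w set" where "J \<phi> = (if w \<in> I \<phi> then UNIV else {})" for \<phi>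
  define Q :: "'w set \<Rightarrow> real" where "Q X = of_bool (X = UNIV)" for X
  have "prob_model UNIV {{}, UNIV} J Q"
    unfolding J_def Q_def using prob_model_of_world[OF model] .
  moreover have "\<forall>\<gamma>\<in>\<Gamma>. Q (J \<gamma>) \<in> \<alpha>"
    using \<Gamma> \<open>upset \<alpha>\<close> by (simp add: J_def Q_def upset_def)
  ultimately obtain \<delta> where "\<delta> \<in> \<Delta>" "Q (J \<delta>) \<in> \<alpha>"
    using valid unfolding preservation_valid_def by blast
  \<comment> \<open>Here \<open>J \<delta>\<close> is empty, so \<open>Q (J \<delta>)\<close> is 0,
    which no upset contains.\<close>
  then show False
    using \<Delta> \<open>upset \<alpha>\<close> by (simp add: J_def Q_def upset_def)
qed

end
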